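(* Let $k\ge 2$ and let $G=(V(G),E(G))$ be a $k$-uniform hypergraph with adjacency matrix $A=(A_{u\,v})$, whose vertex set admits a partition $V(G)=C_1\cup C_2\cup\dots\cup C_{2m}\cup D$ for some integer $m\ge 1$, such that the following conditions hold. (1) $|C_i|=t$ for all $i\in[2m]$ and some integer $t$, while $|D|=k-1$. (2) Any edge of $G$ has either $0$ or $k-1$ vertices in $D$. (3) For any odd $i\in[2m]$, either $\Gamma(D)\cap(C_i\cup C_{i+1})=C_i$ or $|\Gamma(D)\cap C_i|=|\Gamma(D)\cap C_{i+1}|$. (4) For each $i,j\in[2m]$ there exists an integer $\alpha_{i\,j}$ such that $\sum_{u\in C_i}A_{u\,v}=\sum_{u\in C_i}A_{v\,u}=\alpha_{i\,j}$ for every $v\in C_j$, and $\sum_{u\in C_j}A_{u\,v}=\sum_{u\in C_j}A_{v\,u}=\alpha_{i\,j}$ for every $v\in C_i$. (5) For any odd $i,j\in[2m]$, $\alpha_{i\,j}=\alpha_{i+1\,j+1}$ and $\alpha_{i+1\,j}=\alpha_{i\,j+1}$. Let $H$ be the hypergraph on the vertex set $V(G)$ constructed from $G$ as follows: for all odd $i\in[2m]$, if $\Gamma(D)\cap(C_i\cup C_{i+1})=C_i$, then remove all edges of the form $D\cup\{v\}$ with $v\in C_i$ and add the edges $D\cup\{v\}$ for all $v\in C_{i+1}$. Then $H$ and $G$ are cospectral with respect to their matrix representation, i.e. the adjacency matrices of $G$ and $H$ have the same spectrum.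
   Context: Hypergraphs are finite and simple, and $[n]=\{1,\dots,n\}$. A hypergraph $G=(V(G),E(G))$ is $k$-uniform if each edge is a set of exactly $k$ distinct vertices. For a set $D$ of $k-1$ vertices, $\Gamma(D)$ denotes the set of vertices $v$ such that $D\cup\{v\}\in E(G)$. The adjacency matrix of a $k$-uniform hypergraph $G$ is the $|V(G)|\times|V(G)|$ matrix $A=(A_{i\,j})$, with rows and columns indexed by $V(G)$, given by $A_{i\,j}=0$ if $i=j$ and $A_{i\,j}=\frac{|\{e\in E(G)\,:\, i,j\in e\}|}{k-1}$ if $i\ne j$. Two hypergraphs are cospectral with respect to their matrix representation if their adjacency matrices have the same spectrum (the same eigenvalues with multiplicities). *)

theory Defs
  imports "Jordan_Normal_Form.Char_Poly"
begin

record 'a hypergraph =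
  hverts :: "'a set"
  hedges :: "'a set set"

definition uniform_hypergraph :: "nat \<Rightarrow> 'a hypergraph \<Rightarrow> bool" where
  "uniform_hypergraph k G \<longleftrightarrow>
     finite (hverts G) \<and> (\<forall>e\<in>hedges G. e \<subseteq> hverts G \<and> card e = k)"

definition nbrs :: "'a hypergraph \<Rightarrow> 'a set \<Rightarrow> 'a set" where
  "nbrs G D = {v \<in> hverts G. D \<union> {v} \<in> hedges G}"

text \<open>The uniformity \<open>k\<close> is a parameter, since an edgeless hypergraph does not determine it.\<close>

definition adj :: "nat \<Rightarrow> 'a hypergraph \<Rightarrow> 'a \<Rightarrow> 'a \<Rightarrow> real" where
  "adj k G u v =
     (if u = v then 0 else real (card {e \<in> hedges G. u \<in> e \<and> v \<in> e}) / real (k - 1))"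

definition enumerates :: "'a list \<Rightarrow> 'a set \<Rightarrow> bool" where
  "enumerates vs V \<longleftrightarrow> distinct vs \<and> set vs = V"

text \<open>Matrices are indexed by natural numbers, so the adjacency matrix, whose rows and columns
  are indexed by the vertices, is formed along an enumeration \<open>vs\<close> of the vertex set.\<close>

definition adj_mat :: "nat \<Rightarrow> 'a hypergraph \<Rightarrow> 'a list \<Rightarrow> real mat" where
  "adj_mat k G vs = mat (length vs) (length vs) (\<lambda>(i, j). adj k G (vs ! i) (vs ! j))"

text \<open>The multiset of all complex eigenvalues, with algebraic multiplicities.\<close>

definition spectrum_mset :: "real mat \<Rightarrow> complex multiset" where
  "spectrum_mset A = proots (char_poly (map_mat complex_of_real A))"

text \<open>The spectrum does not depend on the enumeration of the vertices; quantifying over all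
  enumerations on both sides avoids having to choose one. A finite vertex set always has one.\<close>

definition cospectral :: "nat \<Rightarrow> 'a hypergraph \<Rightarrow> 'a hypergraph \<Rightarrow> bool" where
  "cospectral k G H \<longleftrightarrow>
     (\<forall>vs ws. enumerates vs (hverts G) \<longrightarrow> enumerates ws (hverts H) \<longrightarrow>
        spectrum_mset (adj_mat k G vs) = spectrum_mset (adj_mat k H ws))"

definition switch_indices ::
    "'a hypergraph \<Rightarrow> (nat \<Rightarrow> 'a set) \<Rightarrow> 'a set \<Rightarrow> nat \<Rightarrow> nat set" where
  "switch_indices G C D m =
     {i \<in> {1..2 * m}. odd i \<and> nbrs G D \<inter> (C i \<union> C (i + 1)) = C i}"

definition switched ::
    "'a hypergraph \<Rightarrow> (nat \<Rightarrow> 'a set) \<Rightarrow> 'a set \<Rightarrow> nat \<Rightarrow> 'a hypergraph" where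
  "switched G C D m =
     \<lparr> hverts = hverts G,
       hedges = (hedges G - {D \<union> {v} |v. \<exists>i\<in>switch_indices G C D m. v \<in> C i})
              \<union> {D \<union> {v} |v. \<exists>i\<in>switch_indices G C D m. v \<in> C (i + 1)} \<rparr>"

end

theory Submission
  imports Defs "HOL-Library.Indicator_Function"
begin

text \<open>Pair up the cells as \<open>(C i, C (i + 1))\<close> with \<open>i\<close> odd, and let \<open>s i\<close> be the indicator function of
  \<open>C i\<close> minus that of \<open>C (i + 1)\<close>. These functions vanish on \<open>D\<close>, are pairwise orthogonal, and all have
  squared norm \<open>2 * t\<close>. Let \<open>Q\<close> be the reflection that negates every \<open>s i\<close> and fixes their orthogonal
  complement: \<open>Q = 1 - (1 / t) * (\<Sum>i. s i * (s i)\<^sup>T)\<close>. It is a symmetric involution, and the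
  claim is that it conjugates the adjacency matrix \<open>A\<close> of \<open>G\<close> into the adjacency matrix \<open>B\<close> of the
  switched hypergraph \<open>H\<close>, so that the two are similar. Compare the blocks of \<open>A\<close> along
  the decomposition of the vertices into \<open>D\<close> and its complement.

  Inside \<open>D\<close> the reflection is the identity. As an edge that meets \<open>D\<close> has the form
  \<open>D \<union> {v}\<close>, the entries there depend only on the number of neighbours of \<open>D\<close>, and switching
  trades \<open>t\<close> neighbours for \<open>t\<close> others in each pair that it affects. So \<open>A\<close> and \<open>B\<close> agree.

  Outside \<open>D\<close> only edges disjoint from \<open>D\<close> count, and these are untouched. The constant cell sums and
  the symmetry under exchanging \<open>C i\<close> with \<open>C (i + 1)\<close> in all pairs at once say that this block of \<open>A\<close>
  maps the span of the \<open>s i\<close> to itself. Being symmetric, the block commutes with the reflection.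

  The entry between \<open>d \<in> D\<close> and \<open>x \<notin> D\<close> is \<open>1 / (k - 1)\<close> if \<open>x\<close> is a neighbour of \<open>D\<close>, and 0 otherwise. On a
  pair with equally many neighbours in both cells this function is orthogonal to \<open>s i\<close> and therefore fixed;
  on a pair where the neighbours are exactly \<open>C i\<close>, the reflection moves the indicator function of \<open>C i\<close> to
  that of \<open>C (i + 1)\<close>. That is precisely the effect of switching.

  The argument is carried out with functions on the vertex set: \<open>reflection_involution\<close> and
  \<open>reflection_intertwines\<close> give \<open>Q * Q = 1\<close> and \<open>A * Q = Q * B\<close>, and
  \<open>spectrum_mset_eq_of_intertwining_involution\<close> turns them into equality of spectra.\<close>

section \<open>Matrices along enumerations of a set\<close>

text \<open>Rows and columns may follow different enumerations. A change of enumeration is thereby absorbed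
  into the conjugating matrix, and no permutation matrices are needed.\<close>

definition list_mat :: "'a list \<Rightarrow> 'a list \<Rightarrow> ('a \<Rightarrow> 'a \<Rightarrow> real) \<Rightarrow> real mat" where
  "list_mat us vs F = mat (length us) (length vs) (\<lambda>(i, j). F (us ! i) (vs ! j))"

lemma list_mat_carrier: "list_mat us vs F \<in> carrier_mat (length us) (length vs)"
  by (simp add: list_mat_def)

lemma sum_nth_enumerates:
  assumes "enumerates ws V"
  shows "(\<Sum>l<length ws. f (ws ! l)) = (\<Sum>w\<in>V. f w)"
proof -
  have "bij_betw ((!) ws) {..<length ws} V"
    using assms by (auto simp: enumerates_def intro: bij_betw_nth)
  then show ?thesis
    by (rule sum.reindex_bij_betw)
qed

lemma list_mat_mult:
  assumes "enumerates ws V"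
  shows "list_mat us ws F * list_mat ws zs G = list_mat us zs (\<lambda>u v. \<Sum>w\<in>V. F u w * G w v)"
  by (rule eq_matI)
    (auto simp: list_mat_def scalar_prod_def sum_nth_enumerates[OF assms, symmetric]
       lessThan_atLeast0)

lemma list_mat_cong:
  assumes "\<And>u v. u \<in> set us \<Longrightarrow> v \<in> set vs \<Longrightarrow> F u v = G u v"
  shows "list_mat us vs F = list_mat us vs G"
  using assms by (auto simp: list_mat_def intro!: cong_mat)

lemma list_mat_delta:
  assumes "distinct vs"
  shows "list_mat vs vs (\<lambda>u v. if u = v then 1 else 0) = 1\<^sub>m (length vs)"
  by (rule eq_matI) (auto simp: list_mat_def nth_eq_iff_index_eq[OF assms])

text \<open>Writing \<open>Q\<close> with rows along one enumeration and columns along the other gives an invertible matrix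
  that conjugates one of the two matrices into the other. Its inverse is \<open>Q\<close> with the roles of the
  enumerations exchanged.\<close>

lemma spectrum_mset_eq_of_intertwining_involution:
  assumes vs: "enumerates vs V" and ws: "enumerates ws V"
    and inv: "\<And>u v. u \<in> V \<Longrightarrow> v \<in> V \<Longrightarrow> (\<Sum>w\<in>V. Q u w * Q w v) = (if u = v then 1 else 0)"
    and twine: "\<And>u v. u \<in> V \<Longrightarrow> v \<in> V \<Longrightarrow>
      (\<Sum>w\<in>V. A u w * Q w v) = (\<Sum>w\<in>V. Q u w * B w v)"
  shows "spectrum_mset (list_mat vs vs A) = spectrum_mset (list_mat ws ws B)"
proof -
  define P where "P = list_mat vs ws Q"
  define P' where "P' = list_mat ws vs Q"
  define n where "n = length vs"
  have len: "length ws = n"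
    using vs ws by (metis enumerates_def distinct_card n_def)
  have setV: "set vs = V" "set ws = V" "distinct vs" "distinct ws"
    using vs ws by (auto simp: enumerates_def)
  have car: "P \<in> carrier_mat n n" "P' \<in> carrier_mat n n"
    "list_mat vs vs A \<in> carrier_mat n n" "list_mat ws ws B \<in> carrier_mat n n"
    using list_mat_carrier len unfolding P_def P'_def n_def by metis+
  have PP': "P * P' = 1\<^sub>m n"
    unfolding P_def P'_def list_mat_mult[OF ws] n_def list_mat_delta[OF setV(3), symmetric]
    by (rule list_mat_cong) (use inv setV in auto)
  have P'P: "P' * P = 1\<^sub>m n"
    unfolding P_def P'_def list_mat_mult[OF vs] len[symmetric] list_mat_delta[OF setV(4), symmetric]
    by (rule list_mat_cong) (use inv setV in auto)
  have AP: "list_mat vs vs A * P = P * list_mat ws ws B"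
    unfolding P_def list_mat_mult[OF ws] list_mat_mult[OF vs]
    by (rule list_mat_cong) (use twine setV in auto)
  have "list_mat vs vs A = list_mat vs vs A * (P * P')"
    using car by (simp add: PP')
  also have "\<dots> = P * list_mat ws ws B * P'"
    using car by (simp add: AP[symmetric] assoc_mult_mat[of _ n n _ n _ n])
  finally have "similar_mat (list_mat vs vs A) (list_mat ws ws B)"
    using car PP' P'P unfolding similar_mat_def similar_mat_wit_def
    by (intro exI[of _ P] exI[of _ P']) (auto simp: Let_def)
  then have "char_poly (list_mat vs vs A) = char_poly (list_mat ws ws B)"
    by (rule char_poly_similar)
  then show ?thesis
    using car by (simp add: spectrum_mset_def of_real_hom.char_poly_hom)
qed

section \<open>Reflections in orthogonal families\<close>

text \<open>The matrix entries of the reflection that negates an orthogonal family of functions \<open>s i\<close>, all of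
  squared norm \<open>2 * t\<close>. The convention \<open>inverse 0 = 0\<close> makes it the identity when \<open>t = 0\<close>, where all
  \<open>s i\<close> vanish, so that no case of empty cells has to be split off.\<close>

definition reflection :: "real \<Rightarrow> 'i set \<Rightarrow> ('i \<Rightarrow> 'a \<Rightarrow> real) \<Rightarrow> 'a \<Rightarrow> 'a \<Rightarrow> real" where
  "reflection t I s u v = (if u = v then 1 else 0) - inverse t * (\<Sum>i\<in>I. s i u * s i v)"

lemma reflection_commute: "reflection t I s u v = reflection t I s v u"
  by (simp add: reflection_def mult.commute)

lemma reflection_apply:
  assumes "finite V" "v \<in> V"
  shows "(\<Sum>w\<in>V. f w * reflection t I s w v)
    = f v - inverse t * (\<Sum>i\<in>I. (\<Sum>w\<in>V. f w * s i w) * s i v)"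
proof -
  have "(\<Sum>w\<in>V. f w * reflection t I s w v)
      = (\<Sum>w\<in>V. if w = v then f w else 0) - (\<Sum>w\<in>V. inverse t * (\<Sum>i\<in>I. f w * s i w * s i v))"
    unfolding sum_subtractf[symmetric]
    by (rule sum.cong) (auto simp: reflection_def algebra_simps sum_distrib_left)
  also have "(\<Sum>w\<in>V. inverse t * (\<Sum>i\<in>I. f w * s i w * s i v))
      = inverse t * (\<Sum>i\<in>I. (\<Sum>w\<in>V. f w * s i w) * s i v)"
    unfolding sum_distrib_left[symmetric] sum_distrib_right by (subst sum.swap) simp
  finally show ?thesis
    using assms by simp
qed

lemma reflection_involution:
  assumes fin: "finite V" "finite I" and u: "u \<in> V" and v: "v \<in> V"
    and orth: "\<And>i j. i \<in> I \<Longrightarrow> j \<in> I \<Longrightarrow> (\<Sum>w\<in>V. s i w * s j w) = (if i = j then 2 * t else 0)"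
  shows "(\<Sum>w\<in>V. reflection t I s u w * reflection t I s w v) = (if u = v then 1 else 0)"
proof -
  have *: "(\<Sum>w\<in>V. reflection t I s u w * s i w) = s i u - inverse t * (2 * t) * s i u"
    if "i \<in> I" for i
  proof -
    have "(\<Sum>w\<in>V. reflection t I s u w * s i w) = (\<Sum>w\<in>V. s i w * reflection t I s w u)"
      by (simp add: mult.commute reflection_commute)
    also have "\<dots> = s i u - inverse t * (\<Sum>j\<in>I. (if i = j then 2 * t else 0) * s j u)"
      using that orth by (simp add: reflection_apply[OF fin(1) u] cong: sum.cong)
    also have "(\<Sum>j\<in>I. (if i = j then 2 * t else 0) * s j u) = (\<Sum>j\<in>I. if i = j then 2 * t * s j u else 0)"
      by (rule sum.cong) auto
    also have "\<dots> = 2 * t * s i u"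
      using that fin by simp
    finally show ?thesis by simp
  qed
  have "(\<Sum>w\<in>V. reflection t I s u w * reflection t I s w v) = reflection t I s u v
      - inverse t * (\<Sum>i\<in>I. (s i u - inverse t * (2 * t) * s i u) * s i v)"
    using * by (simp add: reflection_apply[OF fin(1) v] cong: sum.cong)
  also have "\<dots> = (if u = v then 1 else 0)"
  proof (cases "t = 0")
    case False
    then have "(s i u - inverse t * (2 * t) * s i u) * s i v = - (s i u * s i v)" for i
      by (simp add: field_simps)
    then show ?thesis
      by (simp add: reflection_def sum_negf del: right_diff_distrib left_diff_distrib)
  qed (simp add: reflection_def)
  finally show ?thesis .
qed

text \<open>The hypotheses are those of switching. The functions \<open>s i\<close> live outside \<open>D\<close>, where \<open>A\<close> maps their span to
  itself (\<open>inv\<close>); \<open>B\<close> agrees with \<open>A\<close> on both diagonal blocks (\<open>same\<close>); and the rows of \<open>B\<close> at \<open>D\<close> are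
  the reflected rows of \<open>A\<close> (\<open>cross\<close>). Multiplying out, the entries of \<open>A * Q\<close> and \<open>Q * B\<close> involve the
  inner products \<open>a x i\<close> and \<open>b x i\<close> of \<open>s i\<close> with the rows of \<open>A\<close> and \<open>B\<close> at \<open>x\<close>. In the block outside \<open>D\<close>
  the identity amounts to symmetry of the coefficients \<open>c\<close>. One mixed block is
  \<open>cross\<close> itself; the other follows because reflecting a row negates its inner products with the \<open>s i\<close>.\<close>

lemma reflection_intertwines:
  fixes A B :: "'a \<Rightarrow> 'a \<Rightarrow> real"
  assumes fin: "finite V" "finite I" and u: "u \<in> V" and v: "v \<in> V"
    and orth: "\<And>i j. i \<in> I \<Longrightarrow> j \<in> I \<Longrightarrow> (\<Sum>w\<in>V. s i w * s j w) = (if i = j then 2 * t else 0)"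
    and supp: "\<And>i w. i \<in> I \<Longrightarrow> w \<in> D \<Longrightarrow> s i w = 0"
    and symA: "\<And>x y. A x y = A y x" and symB: "\<And>x y. B x y = B y x"
    and inv: "\<And>i x. i \<in> I \<Longrightarrow> x \<in> V - D \<Longrightarrow> (\<Sum>w\<in>V. A x w * s i w) = (\<Sum>j\<in>I. c i j * s j x)"
    and same: "\<And>x y. x \<in> V \<Longrightarrow> y \<in> V \<Longrightarrow> (x \<in> D \<longleftrightarrow> y \<in> D) \<Longrightarrow> B x y = A x y"
    and cross: "\<And>x d. x \<in> V - D \<Longrightarrow> d \<in> V \<inter> D \<Longrightarrow>
      B d x = A d x - inverse t * (\<Sum>i\<in>I. (\<Sum>w\<in>V. A d w * s i w) * s i x)"
  shows "(\<Sum>w\<in>V. A u w * reflection t I s w v) = (\<Sum>w\<in>V. reflection t I s u w * B w v)"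
proof -
  define a where "a x i = (\<Sum>w\<in>V. A x w * s i w)" for x i
  define b where "b x i = (\<Sum>w\<in>V. B x w * s i w)" for x i
  have L: "(\<Sum>w\<in>V. A u w * reflection t I s w v) = A u v - inverse t * (\<Sum>i\<in>I. a u i * s i v)"
    unfolding a_def by (rule reflection_apply[OF fin(1) v])
  have "(\<Sum>w\<in>V. reflection t I s u w * B w v) = (\<Sum>w\<in>V. B v w * reflection t I s w u)"
    by (simp add: mult.commute reflection_commute symB)
  also have "\<dots> = B v u - inverse t * (\<Sum>i\<in>I. b v i * s i u)"
    unfolding b_def by (rule reflection_apply[OF fin(1) u])
  finally have R: "(\<Sum>w\<in>V. reflection t I s u w * B w v)
      = B v u - inverse t * (\<Sum>i\<in>I. b v i * s i u)" .
  have proj: "(\<Sum>w\<in>V. (\<Sum>l\<in>I. f l * s l w) * s j w) = 2 * t * f j" if "j \<in> I" for f j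
  proof -
    have "(\<Sum>w\<in>V. (\<Sum>l\<in>I. f l * s l w) * s j w) = (\<Sum>l\<in>I. f l * (\<Sum>w\<in>V. s l w * s j w))"
      unfolding sum_distrib_right sum_distrib_left by (subst sum.swap) (simp add: mult.assoc)
    also have "\<dots> = (\<Sum>l\<in>I. if l = j then 2 * t * f l else 0)"
      using that orth by (intro sum.cong) auto
    finally show ?thesis using that fin by simp
  qed
  \<comment> \<open>Symmetry of \<open>A\<close> forces \<open>2 * t * c i j = 2 * t * c j i\<close>. For \<open>t = 0\<close> nothing is known about \<open>c\<close> itself,
    hence the factor \<open>inverse t\<close>, with which \<open>c\<close> is going to occur.\<close>
  have c_sym: "inverse t * c i j = inverse t * c j i" if ij: "i \<in> I" "j \<in> I" for i j
  proof -
    have *: "(\<Sum>x\<in>V. a x i * s j x) = 2 * t * c i j" if ij: "i \<in> I" "j \<in> I" for i j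
    proof -
      have "(\<Sum>x\<in>V. a x i * s j x) = (\<Sum>x\<in>V. (\<Sum>l\<in>I. c i l * s l x) * s j x)"
        using inv supp ij by (intro sum.cong) (force simp: a_def)+
      then show ?thesis using proj[OF ij(2)] by simp
    qed
    have "(\<Sum>x\<in>V. a x i * s j x) = (\<Sum>x\<in>V. a x j * s i x)"
      unfolding a_def sum_distrib_right by (subst sum.swap) (simp add: symA mult_ac)
    then show ?thesis using * ij by (cases "t = 0") auto
  qed
  consider (CC) "u \<notin> D" "v \<notin> D" | (DD) "u \<in> D" "v \<in> D" | (DC) "u \<in> D" "v \<notin> D" | (CD) "u \<notin> D" "v \<in> D"
    by blast
  then show ?thesis
  proof cases
    case CC
    have ba: "b v i = a v i" if "i \<in> I" for i
      unfolding a_def b_def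
    proof (intro sum.cong refl)
      fix w assume "w \<in> V"
      then show "B v w * s i w = A v w * s i w"
        using same[OF v, of w] CC supp[OF that, of w] by (cases "w \<in> D") auto
    qed
    have "inverse t * (\<Sum>i\<in>I. a u i * s i v) = (\<Sum>i\<in>I. \<Sum>j\<in>I. (inverse t * c i j) * s j u * s i v)"
      unfolding a_def using CC u inv by (simp add: sum_distrib_left sum_distrib_right mult_ac cong: sum.cong)
    also have "\<dots> = (\<Sum>i\<in>I. \<Sum>j\<in>I. (inverse t * c j i) * s j u * s i v)"
      using c_sym by (intro sum.cong refl) simp
    also have "\<dots> = (\<Sum>j\<in>I. \<Sum>i\<in>I. (inverse t * c j i) * s j u * s i v)"
      by (rule sum.swap)
    also have "\<dots> = inverse t * (\<Sum>i\<in>I. a v i * s i u)"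
      unfolding a_def using CC v inv by (simp add: sum_distrib_left sum_distrib_right mult_ac cong: sum.cong)
    also have "\<dots> = inverse t * (\<Sum>i\<in>I. b v i * s i u)"
      using ba by (simp cong: sum.cong)
    finally show ?thesis
      using L R same[OF v u] CC symA[of u v] by simp
  next
    case DD
    then have "(\<Sum>i\<in>I. a u i * s i v) = 0" "(\<Sum>i\<in>I. b v i * s i u) = 0"
      using supp by (auto intro!: sum.neutral)
    then show ?thesis
      using L R same[OF v u] DD symA[of u v] by simp
  next
    case DC
    then have "(\<Sum>i\<in>I. b v i * s i u) = 0"
      using supp by (auto intro!: sum.neutral)
    then show ?thesis
      using L R cross[of v u] DC u v symB[of u v] by (simp add: a_def)
  next
    case CD
    have z: "(\<Sum>i\<in>I. a u i * s i v) = 0"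
      using CD supp by (auto intro!: sum.neutral)
    have b: "b v j = a v j - inverse t * (2 * t * a v j)" if j: "j \<in> I" for j
    proof -
      have "b v j = (\<Sum>w\<in>V. (A v w - inverse t * (\<Sum>i\<in>I. a v i * s i w)) * s j w)"
        unfolding b_def using CD v supp[OF j] cross[of _ v]
        by (intro sum.cong refl) (metis (no_types, lifting) DiffI IntI a_def mult_zero_right sum.cong)
      also have "\<dots> = a v j - inverse t * (\<Sum>w\<in>V. (\<Sum>i\<in>I. a v i * s i w) * s j w)"
        by (simp add: a_def left_diff_distrib sum_subtractf sum_distrib_left[symmetric] mult.assoc)
      finally show ?thesis using proj[OF j] by simp
    qed
    have "inverse t * (\<Sum>i\<in>I. b v i * s i u) = - (inverse t * (\<Sum>i\<in>I. a v i * s i u))"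
      unfolding sum_distrib_left sum_negf[symmetric]
    proof (rule sum.cong[OF refl])
      fix j assume "j \<in> I"
      then show "inverse t * (b v j * s j u) = - (inverse t * (a v j * s j u))"
        using b by (cases "t = 0") (simp_all add: field_simps)
    qed
    then show ?thesis
      using L R z cross[of u v] CD u v symA[of u v] by (simp add: a_def)
  qed
qed

section \<open>Adjacency around a set that edges meet fully or not at all\<close>

lemma adj_commute: "adj k G u v = adj k G v u"
  by (auto simp: adj_def conj_commute)

lemma adj_mat_list_mat: "adj_mat k G vs = list_mat vs vs (adj k G)"
  by (simp add: adj_mat_def list_mat_def)

lemma sum_indicator:
  assumes "finite A"
  shows "(\<Sum>x\<in>A. indicator B x :: real) = real (card (B \<inter> A))"
  using sum_mult_indicator[OF assms, of "\<lambda>_. 1 :: real" B] by (simp add: Int_commute)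

text \<open>If \<open>D\<close> has \<open>k - 1\<close> vertices and each edge contains all or none of them, then the edges meeting \<open>D\<close> are
  the sets \<open>D \<union> {v}\<close> for the neighbours \<open>v\<close> of \<open>D\<close>. The three lemmas that follow read off the blocks of the adjacency
  matrix from this. Both the original and the switched hypergraph satisfy the hypotheses.\<close>

lemma edges_meeting_apex_set:
  assumes k: "k \<ge> 2" and G: "uniform_hypergraph k G" and D: "card D = k - 1"
    and dich: "\<forall>e\<in>hedges G. card (e \<inter> D) = 0 \<or> card (e \<inter> D) = k - 1"
  shows "nbrs G D \<inter> D = {}"
    and "e \<in> hedges G \<Longrightarrow> e \<inter> D = {} \<or> (\<exists>v\<in>nbrs G D. e = D \<union> {v})"
proof -
  have finD: "finite D"
    using k D by (intro card_ge_0_finite) simp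
  have "v \<notin> D" if "v \<in> nbrs G D" for v
  proof
    assume "v \<in> D"
    then have "D \<in> hedges G"
      using that by (simp add: nbrs_def insert_absorb)
    then show False
      using G D k by (auto simp: uniform_hypergraph_def)
  qed
  then show "nbrs G D \<inter> D = {}"
    by blast
  assume e: "e \<in> hedges G"
  then have e': "e \<subseteq> hverts G" "card e = k" "finite e"
    using G k by (auto simp: uniform_hypergraph_def dest: finite_subset)
  show "e \<inter> D = {} \<or> (\<exists>v\<in>nbrs G D. e = D \<union> {v})"
  proof (cases "card (e \<inter> D) = 0")
    case True
    then show ?thesis using finD by simp
  next
    case False
    then have "card (e \<inter> D) = card D"
      using dich e D by auto
    then have De: "D \<subseteq> e"
      using card_subset_eq[OF finD, of "e \<inter> D"] by auto
    then have "card (e - D) = 1"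
      using e' D k by (simp add: card_Diff_subset[OF finD])
    then obtain v where "e - D = {v}"
      by (auto simp: card_1_singleton_iff)
    then have "e = D \<union> {v}" "v \<in> e"
      using De by auto
    then show ?thesis
      using e e' by (auto simp: nbrs_def)
  qed
qed

lemma adj_between_apex_set_and_rest:
  assumes "k \<ge> 2" "uniform_hypergraph k G" "card D = k - 1"
    and "\<forall>e\<in>hedges G. card (e \<inter> D) = 0 \<or> card (e \<inter> D) = k - 1"
    and d: "d \<in> D" and u: "u \<notin> D"
  shows "adj k G d u = indicator (nbrs G D) u / real (k - 1)"
proof -
  note E = edges_meeting_apex_set[OF assms(1-4)]
  have "{e \<in> hedges G. d \<in> e \<and> u \<in> e} = (if u \<in> nbrs G D then {D \<union> {u}} else {})"
    using E(2) d u by (auto simp: nbrs_def)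
  then show ?thesis
    using d u by (auto simp: adj_def indicator_def)
qed

lemma adj_inside_apex_set:
  assumes "k \<ge> 2" "uniform_hypergraph k G" "card D = k - 1"
    and "\<forall>e\<in>hedges G. card (e \<inter> D) = 0 \<or> card (e \<inter> D) = k - 1"
    and d: "d \<in> D" "d' \<in> D"
  shows "adj k G d d' = (if d = d' then 0 else real (card (nbrs G D)) / real (k - 1))"
proof -
  note E = edges_meeting_apex_set[OF assms(1-4)]
  have "{e \<in> hedges G. d \<in> e \<and> d' \<in> e} = (\<lambda>v. D \<union> {v}) ` nbrs G D"
    using E(2) d by (auto simp: nbrs_def)
  moreover have "inj_on (\<lambda>v. D \<union> {v}) (nbrs G D)"
    using E(1) by (intro inj_onI) blast
  ultimately show ?thesis
    by (simp add: adj_def card_image)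
qed

lemma adj_outside_apex_set:
  assumes "k \<ge> 2" "uniform_hypergraph k G" "card D = k - 1"
    and "\<forall>e\<in>hedges G. card (e \<inter> D) = 0 \<or> card (e \<inter> D) = k - 1"
    and u: "u \<notin> D" and v: "v \<notin> D"
  shows "adj k G u v = (if u = v then 0
    else real (card {e \<in> hedges G. e \<inter> D = {} \<and> u \<in> e \<and> v \<in> e}) / real (k - 1))"
proof -
  have "{e \<in> hedges G. u \<in> e \<and> v \<in> e} = {e \<in> hedges G. e \<inter> D = {} \<and> u \<in> e \<and> v \<in> e}"
    if "u \<noteq> v"
    using edges_meeting_apex_set(2)[OF assms(1-4)] u v that by blast
  then show ?thesis
    by (simp add: adj_def)
qed

section \<open>Cospectrality of the switched hypergraph\<close>

theorem theorem3p1: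
  fixes k m t :: nat
    and G :: "'a hypergraph"
    and C :: "nat \<Rightarrow> 'a set"
    and D :: "'a set"
    and \<alpha> :: "nat \<Rightarrow> nat \<Rightarrow> int"
  assumes k: "k \<ge> 2"
    and G: "uniform_hypergraph k G"
    and m: "m \<ge> 1"
    and cover: "hverts G = (\<Union>i\<in>{1..2 * m}. C i) \<union> D"
    and disj: "\<forall>i\<in>{1..2 * m}. \<forall>j\<in>{1..2 * m}. i \<noteq> j \<longrightarrow> C i \<inter> C j = {}"
    and disj_D: "\<forall>i\<in>{1..2 * m}. C i \<inter> D = {}"
    and cond1_C: "\<forall>i\<in>{1..2 * m}. card (C i) = t"
    and cond1_D: "card D = k - 1"
    and cond2: "\<forall>e\<in>hedges G. card (e \<inter> D) = 0 \<or> card (e \<inter> D) = k - 1"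
    and cond3: "\<forall>i\<in>{1..2 * m}. odd i \<longrightarrow>
      nbrs G D \<inter> (C i \<union> C (i + 1)) = C i \<or>
      card (nbrs G D \<inter> C i) = card (nbrs G D \<inter> C (i + 1))"
    and cond4: "\<forall>i\<in>{1..2 * m}. \<forall>j\<in>{1..2 * m}.
      (\<forall>v\<in>C j. (\<Sum>u\<in>C i. adj k G u v) = of_int (\<alpha> i j) \<and>
               (\<Sum>u\<in>C i. adj k G v u) = of_int (\<alpha> i j)) \<and>
      (\<forall>v\<in>C i. (\<Sum>u\<in>C j. adj k G u v) = of_int (\<alpha> i j) \<and>
               (\<Sum>u\<in>C j. adj k G v u) = of_int (\<alpha> i j))"
    and cond5: "\<forall>i\<in>{1..2 * m}. \<forall>j\<in>{1..2 * m}. odd i \<longrightarrow> odd j \<longrightarrow>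
      \<alpha> i j = \<alpha> (i + 1) (j + 1) \<and> \<alpha> (i + 1) j = \<alpha> i (j + 1)"
  shows "cospectral k G (switched G C D m)"
proof -
  define V where "V = hverts G"
  define H where "H = switched G C D m"
  define S where "S = switch_indices G C D m"
  define I where "I = {i \<in> {1..2 * m}. odd i}"
  define s :: "nat \<Rightarrow> 'a \<Rightarrow> real" where
    "s i v = indicator (C i) v - indicator (C (i + 1)) v" for i v
  \<comment> \<open>The eventual coefficients: the adjacency matrix of \<open>G\<close> maps \<open>s i\<close> to \<open>\<Sum>j\<in>I. c i j * s j\<close> outside \<open>D\<close>.\<close>
  define c :: "nat \<Rightarrow> nat \<Rightarrow> real" where "c i j = of_int (\<alpha> i j - \<alpha> (i + 1) j)" for i j
  let ?k = "real (k - 1)"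

  have finV: "finite V"
    using G by (simp add: uniform_hypergraph_def V_def)
  have finI: "finite I"
    by (simp add: I_def)
  have I: "i \<in> {1..2 * m}" "i + 1 \<in> {1..2 * m}" "odd i" if "i \<in> I" for i
    using that by (auto simp: I_def) presburger
  have SI: "i \<in> I" if "i \<in> S" for i
    using that by (auto simp: I_def S_def switch_indices_def)
  have S: "C i \<subseteq> nbrs G D" "nbrs G D \<inter> C (i + 1) = {}" if "i \<in> S" for i
  proof -
    have *: "nbrs G D \<inter> (C i \<union> C (i + 1)) = C i"
      using that by (auto simp: S_def switch_indices_def)
    then show "C i \<subseteq> nbrs G D" by blast
    have "C i \<inter> C (i + 1) = {}"
      using disj I[OF SI[OF that]] by (metis n_not_Suc_n Suc_eq_plus1)
    then show "nbrs G D \<inter> C (i + 1) = {}" using * by blast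
  qed
  have CV: "C i \<subseteq> V" "C i \<inter> D = {}" "finite (C i)" "card (C i) = t" if "i \<in> {1..2 * m}" for i
    using that cover disj_D cond1_C finV by (auto simp: V_def dest: finite_subset)
  have DV: "D \<subseteq> V" using cover by (auto simp: V_def)
  have disjC: "C i \<inter> C j = {}" if "i \<in> {1..2 * m}" "j \<in> {1..2 * m}" "i \<noteq> j" for i j
    using disj that by blast
  have twin: "C i \<inter> C (i + 1) = {}" if "i \<in> I" for i
    using disjC[OF I(1)[OF that] I(2)[OF that]] by simp
  have supp: "s i w = 0" if "i \<in> I" "w \<in> D" for i w
    using CV(2)[OF I(1)] CV(2)[OF I(2)] that by (auto simp: s_def indicator_def)
  have sum_s: "(\<Sum>w\<in>V. f w * s i w) = sum f (C i) - sum f (C (i + 1))" if "i \<in> I" for f i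
  proof -
    have "V \<inter> C i = C i" "V \<inter> C (i + 1) = C (i + 1)"
      using CV(1)[OF I(1)] CV(1)[OF I(2)] that by blast+
    then show ?thesis
      by (simp add: s_def right_diff_distrib sum_subtractf sum_mult_indicator[OF finV])
  qed
  have s_val: "s i x = (if p = i then 1 else if p = i + 1 then -1 else 0)"
    if "i \<in> I" "p \<in> {1..2 * m}" "x \<in> C p" for i p x
    using disjC[OF that(2) I(1)] disjC[OF that(2) I(2)] twin[OF that(1)] that
    by (auto simp: s_def indicator_def)
  have outside: "\<exists>j\<in>I. x \<in> C j \<or> x \<in> C (j + 1)" if x: "x \<in> V - D" for x
  proof -
    obtain p where p: "p \<in> {1..2 * m}" "x \<in> C p"
      using x cover by (auto simp: V_def)
    show ?thesis
    proof (cases "odd p")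
      case True
      then show ?thesis using p by (auto simp: I_def)
    next
      case False
      then have "p - 1 \<in> I" "p - 1 + 1 = p"
        using p by (auto simp: I_def)
      then show ?thesis using p by metis
    qed
  qed
  have parity: "j \<noteq> i + 1" if "i \<in> I" "j \<in> I" for i j
    using I(3)[OF that(1)] I(3)[OF that(2)] by auto
  have s_pair: "s i x = 0"
    if "i \<in> I" "j \<in> I" "i \<noteq> j" "x \<in> C j \<or> x \<in> C (j + 1)" for i j x
    using s_val[OF that(1) I(1)[OF that(2)]] s_val[OF that(1) I(2)[OF that(2)]] that(3,4)
      parity[OF that(1,2)] parity[OF that(2,1)] by auto
  have orth: "(\<Sum>w\<in>V. s i w * s j w) = (if i = j then 2 * real t else 0)" if ij: "i \<in> I" "j \<in> I" for i j
  proof -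
    have "(\<Sum>w\<in>C j. s i w) = (if i = j then t else 0)"
      "(\<Sum>w\<in>C (j + 1). s i w) = (if i = j then - real t else 0)"
      using s_val[OF ij(1) I(1)[OF ij(2)]] s_val[OF ij(1) I(2)[OF ij(2)]] parity[OF ij] parity[OF ij(2,1)]
        CV(4) I[OF ij(2)] by (auto cong: sum.cong)
    then show ?thesis using sum_s[OF ij(2), of "s i"] by simp
  qed
  \<comment> \<open>On \<open>C p\<close> the left-hand side is the constant \<open>\<alpha> i p - \<alpha> (i + 1) p\<close>. By the exchange symmetry of \<open>\<alpha>\<close>
    it changes sign between \<open>p = j\<close> and \<open>p = j + 1\<close>, so on that pair it is a multiple of \<open>s j\<close>.\<close>
  have pair: "(\<Sum>w\<in>V. adj k G x w * s i w) = (\<Sum>j\<in>I. c i j * s j x)"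
    if i: "i \<in> I" and x: "x \<in> V - D" for i x
  proof -
    obtain j where j: "j \<in> I" "x \<in> C j \<or> x \<in> C (j + 1)" using outside[OF x] by blast
    have r: "(\<Sum>w\<in>V. adj k G x w * s i w) = of_int (\<alpha> i p - \<alpha> (i + 1) p)"
      if p: "p \<in> {1..2 * m}" "x \<in> C p" for p
      using cond4 I[OF i] p by (simp add: sum_s[OF i])
    have "\<alpha> i j = \<alpha> (i + 1) (j + 1)" "\<alpha> (i + 1) j = \<alpha> i (j + 1)"
      using cond5 I[OF i] I[OF j(1)] by blast+
    then have "(\<Sum>w\<in>V. adj k G x w * s i w) = c i j * s j x"
      using j(2) r[OF I(1)[OF j(1)]] r[OF I(2)[OF j(1)]]
        s_val[OF j(1) I(1)[OF j(1)]] s_val[OF j(1) I(2)[OF j(1)]] by (auto simp: c_def)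
    also have "\<dots> = (\<Sum>l\<in>I. if l = j then c i l * s l x else 0)"
      using j(1) finI by simp
    also have "\<dots> = (\<Sum>l\<in>I. c i l * s l x)"
      using s_pair[OF _ j(1) _ j(2)] by (intro sum.cong) auto
    finally show ?thesis .
  qed

  have finD: "finite D" using finite_subset[OF DV finV] .
  have Hedge: "e \<in> hedges H \<longleftrightarrow>
      e \<in> hedges G \<and> \<not> (\<exists>v. e = D \<union> {v} \<and> (\<exists>i\<in>S. v \<in> C i))
      \<or> (\<exists>v. e = D \<union> {v} \<and> (\<exists>i\<in>S. v \<in> C (i + 1)))" for e
    by (auto simp: H_def switched_def S_def)
  have HV: "hverts H = V" by (simp add: H_def switched_def V_def)
  have new: "D \<union> {v} \<subseteq> V \<and> card (D \<union> {v}) = k \<and> v \<notin> D" if "i \<in> S" "v \<in> C (i + 1)" for i v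
  proof -
    have "v \<in> V" "v \<notin> D"
      using CV(1,2)[OF I(2)[OF SI[OF that(1)]]] that by auto
    then show ?thesis using DV k cond1_D finD by simp
  qed
  have unifH: "uniform_hypergraph k H"
  proof -
    have "e \<subseteq> V \<and> card e = k" if "e \<in> hedges H" for e
      using that new G unfolding Hedge uniform_hypergraph_def V_def by blast
    then show ?thesis
      using finV by (simp add: uniform_hypergraph_def HV)
  qed
  have cond2H: "\<forall>e\<in>hedges H. card (e \<inter> D) = 0 \<or> card (e \<inter> D) = k - 1"
  proof
    fix e assume "e \<in> hedges H"
    then consider "e \<in> hedges G" | i v where "e = D \<union> {v}" "i \<in> S" "v \<in> C (i + 1)"
      unfolding Hedge by blast
    then show "card (e \<inter> D) = 0 \<or> card (e \<inter> D) = k - 1"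
    proof cases
      case 1
      then show ?thesis using cond2 by blast
    next
      case 2
      then have "e \<inter> D = D" using new by blast
      then show ?thesis using cond1_D by simp
    qed
  qed
  have kD: "D \<noteq> {}" using cond1_D k by auto
  have disjoint_edges: "e \<in> hedges H \<longleftrightarrow> e \<in> hedges G" if "e \<inter> D = {}" for e
  proof -
    have "e \<noteq> D \<union> {v}" for v
      using that kD by blast
    then show ?thesis unfolding Hedge by blast
  qed
  note factsG = adj_between_apex_set_and_rest[OF k G cond1_D cond2]
    adj_inside_apex_set[OF k G cond1_D cond2] adj_outside_apex_set[OF k G cond1_D cond2]
  note factsH = adj_between_apex_set_and_rest[OF k unifH cond1_D cond2H]
    adj_inside_apex_set[OF k unifH cond1_D cond2H] adj_outside_apex_set[OF k unifH cond1_D cond2H]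
  note NG = edges_meeting_apex_set(1)[OF k G cond1_D cond2]
  note NH = edges_meeting_apex_set(1)[OF k unifH cond1_D cond2H]
  have nbrsH: "x \<in> nbrs H D \<longleftrightarrow>
      (x \<in> nbrs G D \<and> (\<forall>i\<in>S. x \<notin> C i)) \<or> (\<exists>i\<in>S. x \<in> C (i + 1))" if x: "x \<in> V - D" for x
  proof -
    have "D \<union> {x} = D \<union> {v} \<longleftrightarrow> x = v" for v
      using x by blast
    then have "D \<union> {x} \<in> hedges H \<longleftrightarrow>
        D \<union> {x} \<in> hedges G \<and> \<not> (\<exists>i\<in>S. x \<in> C i) \<or> (\<exists>i\<in>S. x \<in> C (i + 1))"
      unfolding Hedge by metis
    then show ?thesis
      using x unfolding nbrs_def HV V_def by blast
  qed
  \<comment> \<open>Subtracting \<open>s i\<close> from an indicator function that equals that of \<open>C i\<close> on a pair moves it to \<open>C (i + 1)\<close>.\<close>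
  have indH: "indicator (nbrs H D) x = indicator (nbrs G D) x - (\<Sum>i\<in>S. s i x)"
    if x: "x \<in> V - D" for x
  proof -
    obtain j where j: "j \<in> I" "x \<in> C j \<or> x \<in> C (j + 1)" using outside[OF x] by blast
    have finS: "finite S"
      by (rule finite_subset[OF _ finI]) (use SI in blast)
    have "(\<Sum>i\<in>S. s i x) = (\<Sum>i\<in>S. if i = j then s j x else 0)"
      using s_pair[OF SI j(1) _ j(2)] by (intro sum.cong) auto
    then have 1: "(\<Sum>i\<in>S. s i x) = (if j \<in> S then s j x else 0)"
      using finS by simp
    have uniq: "i = j" if i: "i \<in> S" and xi: "x \<in> C i \<or> x \<in> C (i + 1)" for i
    proof -
      have "s i x \<noteq> 0"
        using xi s_val[OF SI[OF i] I(1)[OF SI[OF i]]] s_val[OF SI[OF i] I(2)[OF SI[OF i]]]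
        by auto
      then show ?thesis
        using s_pair[OF SI[OF i] j(1) _ j(2)] by blast
    qed
    then have 2: "x \<in> nbrs H D \<longleftrightarrow>
        (x \<in> nbrs G D \<and> \<not> (j \<in> S \<and> x \<in> C j)) \<or> (j \<in> S \<and> x \<in> C (j + 1))"
      unfolding nbrsH[OF x] by blast
    show ?thesis
    proof (cases "j \<in> S")
      case True
      from j(2) show ?thesis
      proof
        assume xj: "x \<in> C j"
        then have "s j x = 1" "x \<in> nbrs G D" "x \<notin> nbrs H D"
          using s_val[OF j(1) I(1)[OF j(1)] xj] S(1)[OF True] twin[OF j(1)] 2 True xj by auto
        then show ?thesis using 1 True by simp
      next
        assume xj: "x \<in> C (j + 1)"
        then have "s j x = - 1" "x \<notin> nbrs G D" "x \<in> nbrs H D"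
          using s_val[OF j(1) I(2)[OF j(1)] xj] S(2)[OF True] 2 True xj by auto
        then show ?thesis using 1 True by simp
      qed
    next
      case False
      then show ?thesis
        using 1 2 by (simp add: indicator_def)
    qed
  qed
  have sum_s0: "(\<Sum>w\<in>V. s i w) = 0" if "i \<in> I" for i
    using sum_s[OF that, of "\<lambda>_. 1"] CV(4) I[OF that] by simp
  have card_nbrs: "card (nbrs H D) = card (nbrs G D)"
  proof -
    have card_ind: "real (card N) = (\<Sum>w\<in>V - D. indicator N w)" if "N \<subseteq> V - D" for N
      using that finV by (simp add: sum_indicator Int_absorb2)
    have "real (card (nbrs H D)) = (\<Sum>w\<in>V - D. indicator (nbrs H D) w)"
      using NH by (intro card_ind) (auto simp: nbrs_def HV)
    also have "\<dots> = (\<Sum>w\<in>V - D. indicator (nbrs G D) w) - (\<Sum>i\<in>S. \<Sum>w\<in>V - D. s i w)"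
      by (subst sum.swap) (simp add: indH sum_subtractf)
    also have "(\<Sum>i\<in>S. \<Sum>w\<in>V - D. s i w) = 0"
    proof (rule sum.neutral, rule ballI)
      fix i assume "i \<in> S"
      then have i: "i \<in> I" by (rule SI)
      have "(\<Sum>w\<in>V - D. s i w) = (\<Sum>w\<in>V. s i w)"
        using supp[OF i] finV by (intro sum.mono_neutral_left) auto
      then show "(\<Sum>w\<in>V - D. s i w) = 0" using sum_s0[OF i] by simp
    qed
    also have "(\<Sum>w\<in>V - D. indicator (nbrs G D) w) = real (card (nbrs G D))"
      using NG by (intro card_ind[symmetric]) (auto simp: nbrs_def V_def)
    finally show ?thesis by simp
  qed
  have same: "adj k H x y = adj k G x y" if "x \<in> D \<longleftrightarrow> y \<in> D" for x y
  proof (cases "x \<in> D")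
    case True
    then show ?thesis using that factsG factsH card_nbrs by simp
  next
    case False
    have "{e \<in> hedges H. e \<inter> D = {} \<and> x \<in> e \<and> y \<in> e}
        = {e \<in> hedges G. e \<inter> D = {} \<and> x \<in> e \<and> y \<in> e}"
      using disjoint_edges by blast
    then show ?thesis using that False factsG(3) factsH(3) by simp
  qed
  \<comment> \<open>The inner product compares the numbers of neighbours in the two cells: \<open>t\<close> against 0 on a switched
    pair, and equal numbers otherwise.\<close>
  have aD: "(\<Sum>w\<in>V. adj k G d w * s i w) = (if i \<in> S then t / ?k else 0)"
    if i: "i \<in> I" and d: "d \<in> D" for i d
  proof -
    have sumC: "(\<Sum>w\<in>C p. adj k G d w) = card (nbrs G D \<inter> C p) / ?k" if p: "p \<in> {1..2 * m}" for p
    proof -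
      have "(\<Sum>w\<in>C p. adj k G d w) = (\<Sum>w\<in>C p. indicator (nbrs G D) w / ?k)"
        using CV(2)[OF p] d by (intro sum.cong refl factsG(1)) auto
      then show ?thesis
        using CV(3)[OF p] by (simp add: sum_divide_distrib[symmetric] sum_indicator)
    qed
    have *: "(\<Sum>w\<in>V. adj k G d w * s i w)
        = card (nbrs G D \<inter> C i) / ?k - card (nbrs G D \<inter> C (i + 1)) / ?k"
      using I[OF i] by (simp add: sum_s[OF i] sumC del: One_nat_def)
    show ?thesis
    proof (cases "i \<in> S")
      case True
      then show ?thesis using * S[OF True] CV(4) I[OF i] by (simp add: Int_absorb1)
    next
      case False
      then have "card (nbrs G D \<inter> C i) = card (nbrs G D \<inter> C (i + 1))"
        using cond3 I[OF i] by (auto simp: S_def switch_indices_def)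
      then show ?thesis using * False by simp
    qed
  qed
  have cross: "adj k H d x = adj k G d x
      - inverse (real t) * (\<Sum>i\<in>I. (\<Sum>w\<in>V. adj k G d w * s i w) * s i x)"
    if x: "x \<in> V - D" and d: "d \<in> V \<inter> D" for x d
  proof -
    \<comment> \<open>Cancelling \<open>t\<close> is harmless when \<open>t = 0\<close>, because the cells are then empty and \<open>s i\<close> vanishes.\<close>
    have scale: "inverse (real t) * (t / ?k * s i x) = s i x / ?k" if "i \<in> S" for i
    proof (cases "t = 0")
      case True
      then have "C i = {}" "C (i + 1) = {}"
        using CV(3,4) I[OF SI[OF that]] by (metis card_0_eq)+
      then show ?thesis by (simp add: s_def)
    qed simp
    have "inverse (real t) * (\<Sum>i\<in>I. (\<Sum>w\<in>V. adj k G d w * s i w) * s i x)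
        = inverse (real t) * (\<Sum>i\<in>S. t / ?k * s i x)"
      using aD d SI finI by (intro arg_cong2[of _ _ _ _ "(*)"] refl sum.mono_neutral_cong_right) auto
    also have "\<dots> = (\<Sum>i\<in>S. s i x) / ?k"
      unfolding sum_distrib_left sum_divide_distrib by (rule sum.cong[OF refl scale])
    finally show ?thesis
      using x d factsG(1)[of d x] factsH(1)[of d x] indH[OF x] by (simp add: diff_divide_distrib)
  qed
  show ?thesis
    unfolding cospectral_def H_def[symmetric] HV V_def[symmetric] adj_mat_list_mat
  proof (intro allI impI)
    fix vs ws assume "enumerates vs V" "enumerates ws V"
    then show "spectrum_mset (list_mat vs vs (adj k G)) = spectrum_mset (list_mat ws ws (adj k H))"
    proof (rule spectrum_mset_eq_of_intertwining_involution[where Q = "reflection (real t) I s"])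
      show "(\<Sum>w\<in>V. reflection (real t) I s u w * reflection (real t) I s w v)
          = (if u = v then 1 else 0)" if "u \<in> V" "v \<in> V" for u v
        using reflection_involution[OF finV finI that orth] .
      show "(\<Sum>w\<in>V. adj k G u w * reflection (real t) I s w v)
          = (\<Sum>w\<in>V. reflection (real t) I s u w * adj k H w v)" if "u \<in> V" "v \<in> V" for u v
        by (rule reflection_intertwines[OF finV finI that orth supp adj_commute adj_commute pair same cross])
    qed
  qed
qed

end
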